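(* Let $\ell$ be a positive integer, let $0<\alpha_\ell<\dots<\alpha_2<\alpha_1\le1$, and let $q_2,\dots,q_\ell$ be positive constants. Assume that $1<\beta<1+\alpha_1$ and $\lambda>0$. Then $$\tilde E(t):=E_{(\alpha_1,\alpha_1-\alpha_\ell,\dots,\alpha_1-\alpha_3,\alpha_1-\alpha_2),\beta}\bigl(-\lambda t^{\alpha_1},-q_\ell t^{\alpha_1-\alpha_\ell},\dots,-q_3t^{\alpha_1-\alpha_3},-q_2t^{\alpha_1-\alpha_2}\bigr)>0\qquad\text{for all }t>0.$$
   Context: The multinomial Mittag-Leffler function is defined, for a positive integer $n$, $\beta_0\in(0,2)$, $0<\beta_j\le1$ and $s_j\in\mathbb R$ ($j=1,\dots,n$), by $$E_{(\beta_1,\dots,\beta_n),\beta_0}(s_1,\dots,s_n):=\sum_{k=0}^\infty\ \sum_{k_1+\dots+k_n=k}\frac{k!}{k_1!\cdots k_n!}\,\frac{\prod_{j=1}^ns_j^{k_j}}{\Gamma\bigl(\beta_0+\sum_{j=1}^n\beta_jk_j\bigr)},$$ where the $k_j$ range over nonnegative integers. *)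

theory Defs
  imports "HOL-Analysis.Analysis"
begin

text \<open>
  The number of variables is the common length of the parameter list \<open>bs\<close> = \<open>[\<beta>\<^sub>1, \<dots>, \<beta>\<^sub>n]\<close> and the
  argument list \<open>ss\<close> = \<open>[s\<^sub>1, \<dots>, s\<^sub>n]\<close>; entries are 0-based, so \<open>bs ! j\<close> is \<open>\<beta>\<^sub>j\<^sub>+\<^sub>1\<close>.
  The function is meant for \<open>length ss = length bs \<ge> 1\<close>, \<open>0 < b0 < 2\<close> and entries of \<open>bs\<close>
  in \<open>(0,1]\<close>, where the outer series converges; the inner sum is over a finite set.
\<close>

definition multinomial_ML :: "real list \<Rightarrow> real \<Rightarrow> real list \<Rightarrow> real" where
  "multinomial_ML bs b0 ss =
     (\<Sum>k. \<Sum>ks | length ks = length bs \<and> sum_list ks = k.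
        fact k / (\<Prod>j<length bs. fact (ks ! j))
        * ((\<Prod>j<length bs. (ss ! j) ^ (ks ! j))
           / Gamma (b0 + (\<Sum>j<length bs. bs ! j * real (ks ! j)))))"

end

theory Submission
  imports Defs
begin

text \<open>
  Multiplying the Mittag-Leffler function by \<open>t powr (\<beta> - 1)\<close> turns it into the solution of a Volterra
  equation, and positivity is a comparison property of such equations. Write
  \<open>g\<^sub>b(t) = t powr (b - 1) / Gamma b\<close> for the Riemann--Liouville kernel; the beta integral says
  \<open>g\<^sub>a * g\<^sub>b = g\<^sub>a\<^sub>+\<^sub>b\<close> for convolution on \<open>(0, t)\<close>. Put \<open>k = (\<Sum>j. c\<^sub>j g\<^bsub>a j\<^esub>)\<close>, where \<open>a\<^sub>j\<close> are the
  exponents and \<open>- c\<^sub>j t powr a\<^sub>j\<close> the arguments of the Mittag-Leffler function. Its \<open>m\<close>-th block,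
  multiplied by \<open>t powr (\<beta> - 1)\<close>, is \<open>u\<^sub>m = (-1)\<^sup>m k * \<dots> * k * g\<^sub>\<beta>\<close> with \<open>m\<close> factors \<open>k\<close>: the multinomial
  coefficients satisfy Pascal's recursion, which is exactly \<open>u\<^sub>m\<^sub>+\<^sub>1 = - k * u\<^sub>m\<close>. So the series
  \<open>u = (\<Sum>m. u\<^sub>m)\<close> is the Neumann series of \<open>u + k * u = g\<^sub>\<beta>\<close> (lemma \<open>solution_volterra\<close>).

  Since all \<open>a\<^sub>j \<le> 1\<close>, the kernel \<open>k\<close> is nonincreasing, and since \<open>\<beta> \<ge> 1\<close>, the right-hand side is
  nondecreasing. These two monotonicities force \<open>u > 0\<close> (lemma \<open>volterra_solution_pos\<close>): just before
  a first zero \<open>T\<close>, comparing the equation at \<open>x < T\<close> and at \<open>T\<close> bounds \<open>u(x)\<close> by the integral of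
  \<open>k(T - s) u(s)\<close> over \<open>(x, T)\<close>, and such a Gronwall inequality with an integrable kernel makes \<open>u\<close>
  vanish to the left of \<open>T\<close>.

  All convergence questions are settled by one estimate, \<open>g\<^sub>b(t) \<le> \<sigma> powr (1 - b) * exp (\<sigma> t)\<close> for
  every \<open>\<sigma> > 0\<close> and \<open>b \<ge> 1\<close>. With the multinomial theorem it bounds \<open>u\<^sub>m\<close> by a geometric sequence of
  ratio \<open>(\<Sum>j. c\<^sub>j \<sigma> powr (- a\<^sub>j))\<close>. A large fixed \<open>\<sigma>\<close> gives locally uniform convergence; the choice
  \<open>\<sigma> = 1 / t\<close> shows that \<open>u\<^sub>0 = g\<^sub>\<beta>\<close> dominates as \<open>t\<close> tends to 0, so that \<open>u > 0\<close> near 0.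
\<close>

section \<open>Positivity for Volterra equations with nonincreasing kernel\<close>

text \<open>
  At a first point \<open>T\<close> with \<open>u T \<le> 0\<close>, replacing \<open>k (T - s)\<close> by the larger \<open>k (x - s)\<close> on \<open>(0, x)\<close> and
  \<open>f T\<close> by the smaller \<open>f x\<close> in the equation leaves only the contribution of \<open>(x, T)\<close>. So on an interval
  ending at \<open>T\<close> where \<open>k (T - s)\<close> has integral less than 1, \<open>u\<close> would be strictly smaller than its own
  maximum. Positivity near 0 is what makes a first \<open>T > 0\<close> exist.
\<close>

lemma volterra_solution_pos:
  fixes k f u :: "real \<Rightarrow> real"
  assumes k_nonneg: "\<And>x. 0 \<le> x \<Longrightarrow> 0 \<le> k x"
    and k_antimono: "\<And>x y. 0 < x \<Longrightarrow> x \<le> y \<Longrightarrow> k y \<le> k x"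
    and k_int: "\<And>t. 0 < t \<Longrightarrow> (\<lambda>s. k (t - s)) integrable_on {0..t}"
    and f_mono: "\<And>x y. 0 < x \<Longrightarrow> x \<le> y \<Longrightarrow> f x \<le> f y"
    and u_cont: "continuous_on {0<..} u"
    and u_eq: "\<And>t. 0 < t \<Longrightarrow> ((\<lambda>s. k (t - s) * u s) has_integral (f t - u t)) {0..t}"
    and u_near: "0 < d" "\<And>t. 0 < t \<Longrightarrow> t < d \<Longrightarrow> 0 < u t"
    and "0 < t"
  shows "0 < u t"
proof (rule ccontr)
  assume "\<not> 0 < u t"
  define Z where "Z = {d/2..t} \<inter> u -` {..0}"
  have "continuous_on {d/2..t} u"
    by (rule continuous_on_subset[OF u_cont]) (use u_near in auto)
  then have "closed Z"
    unfolding Z_def by (intro continuous_closed_preimage) auto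
  then have "compact Z"
    by (metis Z_def compact_Icc compact_Int_closed inf.left_idem Int_commute)
  moreover have "t \<in> Z"
    using \<open>\<not> 0 < u t\<close> \<open>0 < t\<close> u_near(1) u_near(2)[of t] by (force simp: Z_def)
  ultimately obtain T where "T \<in> Z" and T_min: "\<And>x. x \<in> Z \<Longrightarrow> T \<le> x"
    using compact_attains_inf[of Z] by auto
  then have "0 < T" and uT: "u T \<le> 0" and "T \<le> t"
    using u_near by (auto simp: Z_def)
  have u_pos: "0 < u x" if "0 < x" "x < T" for x
  proof (rule ccontr)
    assume neg: "\<not> 0 < u x"
    then have "d \<le> x" using u_near(2)[of x] \<open>0 < x\<close> by force
    then have "x \<in> Z" using neg that \<open>T \<le> t\<close> u_near(1) by (auto simp: Z_def)
    then show False using T_min[of x] \<open>x < T\<close> by simp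
  qed
  \<comment> \<open>Subtracting the equation at \<open>x\<close> from the one at \<open>T\<close>.\<close>
  have bound: "u x \<le> integral {x..T} (\<lambda>s. k (T - s) * u s)" if "0 < x" "x < T" for x
  proof -
    have int_T: "(\<lambda>s. k (T - s) * u s) integrable_on {0..T}"
      using u_eq[OF \<open>0 < T\<close>] by blast
    then have split: "f T - u T = integral {0..x} (\<lambda>s. k (T - s) * u s)
        + integral {x..T} (\<lambda>s. k (T - s) * u s)"
      using Henstock_Kurzweil_Integration.integral_combine[OF _ _ int_T, of x] that
        integral_unique[OF u_eq[OF \<open>0 < T\<close>]] by simp
    \<comment> \<open>The open interval avoids \<open>s = x\<close>, where \<open>k 0\<close> need not dominate \<open>k (T - x)\<close>.\<close>
    have "integral {0<..<x} (\<lambda>s. k (T - s) * u s) \<le> integral {0<..<x} (\<lambda>s. k (x - s) * u s)"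
    proof (rule integral_le)
      show "(\<lambda>s. k (T - s) * u s) integrable_on {0<..<x}"
        using integrable_subinterval_real[OF int_T, of 0 x] that
        by (simp add: integrable_on_Icc_iff_Ioo)
      show "(\<lambda>s. k (x - s) * u s) integrable_on {0<..<x}"
        using u_eq[OF \<open>0 < x\<close>] unfolding has_integral_Icc_iff_Ioo by blast
      show "k (T - s) * u s \<le> k (x - s) * u s" if "s \<in> {0<..<x}" for s
        using that \<open>x < T\<close> u_pos[of s] by (intro mult_right_mono k_antimono) auto
    qed
    then have "integral {0..x} (\<lambda>s. k (T - s) * u s) \<le> f x - u x"
      using integral_unique[OF u_eq[OF \<open>0 < x\<close>]] by (simp add: integral_open_interval_real)
    with split f_mono[of x T] uT that show ?thesis by linarith
  qed
  \<comment> \<open>The mass \<open>K x\<close> of the kernel on \<open>[x, T]\<close> tends to 0 as \<open>x\<close> tends to \<open>T\<close>.\<close>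
  define K where "K = (\<lambda>x. integral {x..T} (\<lambda>s. k (T - s)))"
  have "continuous_on {0..T} K"
    unfolding K_def by (rule indefinite_integral_continuous_1'[OF k_int[OF \<open>0 < T\<close>]])
  then have "(K \<longlongrightarrow> K T) (at T within {0..T})"
    using \<open>0 < T\<close> by (simp add: continuous_on)
  moreover have "K T = 0" by (simp add: K_def)
  ultimately have "eventually (\<lambda>x. K x < 1) (at T within {0..T})"
    by (metis order_tendstoD(2) zero_less_one)
  then obtain e where "0 < e" and e: "\<And>x. x \<in> {0..T} \<Longrightarrow> x \<noteq> T \<Longrightarrow> dist x T < e \<Longrightarrow> K x < 1"
    unfolding eventually_at by blast
  define x0 where "x0 = max (T/2) (T - e/2)"
  have x0: "0 < x0" "x0 < T" "T - e < x0"
    using \<open>0 < T\<close> \<open>0 < e\<close> by (auto simp: x0_def)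
  have "continuous_on {x0..T} u"
    by (rule continuous_on_subset[OF u_cont]) (use x0 in auto)
  then obtain y where y: "y \<in> {x0..T}" and y_max: "\<And>x. x \<in> {x0..T} \<Longrightarrow> u x \<le> u y"
    using continuous_attains_sup[of "{x0..T}" u] x0 by auto
  have "0 < u y" using y_max[of x0] u_pos[OF x0(1,2)] x0 by auto
  then have "y < T" using uT y by (cases "y = T") auto
  have "0 < y" using y x0 by auto
  have "u y \<le> integral {y..T} (\<lambda>s. k (T - s) * u s)"
    using bound \<open>0 < y\<close> \<open>y < T\<close> by blast
  also have "\<dots> \<le> integral {y..T} (\<lambda>s. k (T - s) * u y)"
  proof (rule integral_le)
    show "(\<lambda>s. k (T - s) * u s) integrable_on {y..T}"
      using u_eq[OF \<open>0 < T\<close>] \<open>0 < y\<close> by (auto intro: integrable_subinterval_real)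
    show "(\<lambda>s. k (T - s) * u y) integrable_on {y..T}"
      using k_int[OF \<open>0 < T\<close>] \<open>0 < y\<close>
      by (intro integrable_on_mult_left) (auto intro: integrable_subinterval_real)
    show "k (T - s) * u s \<le> k (T - s) * u y" if "s \<in> {y..T}" for s
      using that y by (intro mult_left_mono k_nonneg y_max) auto
  qed
  also have "\<dots> = K y * u y" by (simp add: K_def)
  also have "\<dots> < 1 * u y"
    using e[of y] y x0 \<open>y < T\<close> \<open>0 < u y\<close> by (intro mult_strict_right_mono) (auto simp: dist_real_def)
  finally show False by simp
qed

section \<open>Multinomial sums\<close>

definition weak_compositions :: "nat \<Rightarrow> nat \<Rightarrow> nat list set" where
  "weak_compositions n k = {ks. length ks = n \<and> sum_list ks = k}"

definition multinomial_sum :: "nat \<Rightarrow> nat \<Rightarrow> (nat list \<Rightarrow> real) \<Rightarrow> real" where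
  "multinomial_sum n k F = (\<Sum>ks\<in>weak_compositions n k. fact k / (\<Prod>j<n. fact (ks ! j)) * F ks)"

lemma weak_compositions_0: "weak_compositions n 0 = {replicate n 0}"
  by (auto simp: weak_compositions_def replicate_eqI)

lemma prod_power_list_update_Suc:
  fixes x :: "nat \<Rightarrow> real"
  assumes "length ks = n" "j < n"
  shows "(\<Prod>i<n. x i ^ (ks[j := Suc (ks ! j)] ! i)) = x j * (\<Prod>i<n. x i ^ (ks ! i))"
proof -
  have "(\<Prod>i<n. x i ^ (ks[j := Suc (ks ! j)] ! i))
      = x j ^ Suc (ks ! j) * (\<Prod>i\<in>{..<n} - {j}. x i ^ (ks ! i))"
    using assms by (subst prod.remove[of _ j]) (auto intro!: prod.cong)
  also have "\<dots> = x j * (\<Prod>i<n. x i ^ (ks ! i))"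
    using assms by (subst (2) prod.remove[of _ j]) auto
  finally show ?thesis .
qed

lemma sum_list_update_Suc:
  fixes a :: "nat \<Rightarrow> real"
  assumes "length ks = n" "j < n"
  shows "(\<Sum>i<n. a i * real (ks[j := Suc (ks ! j)] ! i)) = a j + (\<Sum>i<n. a i * real (ks ! i))"
proof -
  have "(\<Sum>i<n. a i * real (ks[j := Suc (ks ! j)] ! i))
      = a j * real (Suc (ks ! j)) + (\<Sum>i\<in>{..<n} - {j}. a i * real (ks ! i))"
    using assms by (subst sum.remove[of _ j]) (auto intro!: sum.cong)
  also have "\<dots> = a j + (\<Sum>i<n. a i * real (ks ! i))"
    using assms by (subst (2) sum.remove[of _ j]) (auto simp: algebra_simps)
  finally show ?thesis .
qed

lemma finite_weak_compositions [simp]: "finite (weak_compositions n k)"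
proof (rule finite_subset)
  show "weak_compositions n k \<subseteq> {ks. set ks \<subseteq> {..k} \<and> length ks = n}"
    by (auto simp: weak_compositions_def member_le_sum_list)
qed (simp add: finite_lists_length_eq)

text \<open>
  Pascal's recursion for multinomial coefficients: a composition of \<open>k + 1\<close> arises from one of \<open>k\<close> by
  raising one entry \<open>j\<close>, and the coefficient \<open>k! / \<Prod> ks!\<close> of the predecessor equals
  \<open>k! ls\<^sub>j / \<Prod> ls!\<close>. Summing over \<open>j\<close> gives \<open>(k + 1)! / \<Prod> ls!\<close> because \<open>\<Sum> ls\<^sub>j = k + 1\<close>. For a general
  weight \<open>F\<close> the recursion serves both the multinomial theorem and the Volterra iteration.
\<close>

lemma multinomial_sum_Suc:
  "multinomial_sum n (Suc k) F
    = (\<Sum>j<n. multinomial_sum n k (\<lambda>ks. F (ks[j := Suc (ks ! j)])))"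
proof -
  define P :: "nat list \<Rightarrow> real" where "P = (\<lambda>ks. \<Prod>i<n. fact (ks ! i))"
  have P_pos: "P ks > 0" for ks by (simp add: P_def prod_pos)
  have sum_P: "multinomial_sum n m G = (\<Sum>ks\<in>weak_compositions n m. fact m / P ks * G ks)" for m G
    by (simp add: multinomial_sum_def P_def)
  have "multinomial_sum n k (\<lambda>ks. F (ks[j := Suc (ks ! j)]))
      = (\<Sum>ls\<in>weak_compositions n (Suc k). fact k * real (ls ! j) / P ls * F ls)" if "j < n" for j
  proof -
    have P_Suc: "P (ks[j := Suc (ks ! j)]) = real (Suc (ks ! j)) * P ks" if "length ks = n" for ks
    proof -
      have "P (ks[j := Suc (ks ! j)]) = fact (Suc (ks ! j)) * (\<Prod>i\<in>{..<n} - {j}. fact (ks ! i))"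
        unfolding P_def using that \<open>j < n\<close>
        by (subst prod.remove[of _ j]) (auto intro!: prod.cong)
      also have "\<dots> = real (Suc (ks ! j)) * P ks"
        unfolding P_def using that \<open>j < n\<close> by (subst (2) prod.remove[of _ j]) auto
      finally show ?thesis .
    qed
    have "multinomial_sum n k (\<lambda>ks. F (ks[j := Suc (ks ! j)]))
        = (\<Sum>ls | ls \<in> weak_compositions n (Suc k) \<and> 0 < ls ! j. fact k * real (ls ! j) / P ls * F ls)"
      unfolding sum_P
    proof (rule sum.reindex_bij_witness[where j = "\<lambda>ks. ks[j := Suc (ks ! j)]"
          and i = "\<lambda>ls. ls[j := ls ! j - 1]"], goal_cases)
      case (5 ks)
      then have "length ks = n" by (simp add: weak_compositions_def)
      then show ?case using P_Suc[of ks] P_pos[of ks] \<open>j < n\<close> by simp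
    next
      case (4 ls)
      then have "ls ! j \<le> sum_list ls"
        using \<open>j < n\<close> elem_le_sum_list[of j ls] by (simp add: weak_compositions_def)
      with 4 show ?case using \<open>j < n\<close> by (auto simp: weak_compositions_def sum_list_update)
    qed (use \<open>j < n\<close> in \<open>auto simp: weak_compositions_def sum_list_update\<close>)
    also have "\<dots> = (\<Sum>ls\<in>weak_compositions n (Suc k). fact k * real (ls ! j) / P ls * F ls)"
      by (rule sum.mono_neutral_left) auto
    finally show ?thesis .
  qed
  then have "(\<Sum>j<n. multinomial_sum n k (\<lambda>ks. F (ks[j := Suc (ks ! j)])))
      = (\<Sum>j<n. \<Sum>ls\<in>weak_compositions n (Suc k). fact k * real (ls ! j) / P ls * F ls)"
    by simp
  also have "\<dots> = (\<Sum>ls\<in>weak_compositions n (Suc k). \<Sum>j<n. fact k * real (ls ! j) / P ls * F ls)"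
    by (rule sum.swap)
  also have "\<dots> = (\<Sum>ls\<in>weak_compositions n (Suc k). fact (Suc k) / P ls * F ls)"
  proof (rule sum.cong[OF refl])
    fix ls assume "ls \<in> weak_compositions n (Suc k)"
    then have "(\<Sum>j<n. ls ! j) = Suc k"
      by (auto simp: weak_compositions_def sum_list_sum_nth atLeast0LessThan)
    then have "(\<Sum>j<n. real (ls ! j)) = real (Suc k)"
      by (metis of_nat_sum)
    moreover have "(\<Sum>j<n. fact k * real (ls ! j) / P ls * F ls)
        = fact k * (\<Sum>j<n. real (ls ! j)) / P ls * F ls"
      by (simp add: sum_distrib_left sum_distrib_right sum_divide_distrib)
    ultimately show "(\<Sum>j<n. fact k * real (ls ! j) / P ls * F ls) = fact (Suc k) / P ls * F ls"
      by (simp add: mult.commute)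
  qed
  finally show ?thesis by (simp add: sum_P)
qed

lemma multinomial_sum_cong:
  "(\<And>ks. length ks = n \<Longrightarrow> F ks = G ks) \<Longrightarrow> multinomial_sum n k F = multinomial_sum n k G"
  unfolding multinomial_sum_def by (rule sum.cong) (auto simp: weak_compositions_def)

lemma multinomial_sum_mult: "multinomial_sum n k (\<lambda>ks. c * F ks) = c * multinomial_sum n k F"
  by (simp add: multinomial_sum_def sum_distrib_left mult_ac)

lemma multinomial_sum_0: "multinomial_sum n 0 F = F (replicate n 0)"
  by (simp add: multinomial_sum_def weak_compositions_0)

lemma multinomial_theorem:
  "multinomial_sum n k (\<lambda>ks. \<Prod>j<n. x j ^ (ks ! j)) = (\<Sum>j<n. x j) ^ k"
proof (induction k)
  case 0
  show ?case by (simp add: multinomial_sum_0)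
next
  case (Suc k)
  have "multinomial_sum n (Suc k) (\<lambda>ks. \<Prod>j<n. x j ^ (ks ! j))
      = (\<Sum>j<n. x j * multinomial_sum n k (\<lambda>ks. \<Prod>i<n. x i ^ (ks ! i)))"
    unfolding multinomial_sum_Suc multinomial_sum_mult[symmetric]
    by (intro sum.cong multinomial_sum_cong prod_power_list_update_Suc) auto
  then show ?case by (simp add: Suc.IH sum_distrib_right)
qed

lemma abs_multinomial_sum_le:
  assumes "\<And>ks. length ks = n \<Longrightarrow> \<bar>F ks\<bar> \<le> G ks"
  shows "\<bar>multinomial_sum n k F\<bar> \<le> multinomial_sum n k G"
  unfolding multinomial_sum_def
proof (rule order.trans[OF sum_abs sum_mono])
  fix ks assume "ks \<in> weak_compositions n k"
  then have "\<bar>F ks\<bar> \<le> G ks" using assms by (simp add: weak_compositions_def)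
  moreover have "0 \<le> fact k / (\<Prod>j<n. fact (ks ! j) :: real)"
    by (simp add: prod_nonneg)
  ultimately show "\<bar>fact k / (\<Prod>j<n. fact (ks ! j)) * F ks\<bar>
      \<le> fact k / (\<Prod>j<n. fact (ks ! j)) * G ks"
    by (metis abs_mult abs_of_nonneg mult_left_mono)
qed

lemma has_integral_multinomial_sum:
  assumes "\<And>ks. length ks = n \<Longrightarrow> (G ks has_integral I ks) S"
  shows "((\<lambda>s. multinomial_sum n k (\<lambda>ks. G ks s)) has_integral multinomial_sum n k I) S"
  unfolding multinomial_sum_def
  by (intro has_integral_sum has_integral_mult_right assms) (simp, simp add: weak_compositions_def)

section \<open>Riemann--Liouville kernels\<close>

text \<open>
  The power \<open>t powr (b - 1)\<close> is at least \<open>x powr (b - 1)\<close> for \<open>t \<ge> x\<close>, so the part of Euler's integral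
  over \<open>[x, \<infinity>)\<close> alone contributes at least \<open>x powr (b - 1) * exp (- x)\<close> to \<open>Gamma b\<close>.
\<close>

lemma powr_le_exp_mult_Gamma:
  fixes b x :: real
  assumes "1 \<le> b" "0 \<le> x"
  shows "x powr (b - 1) \<le> exp x * Gamma b"
proof -
  have Gam: "((\<lambda>t. t powr (b - 1) / exp t) has_integral Gamma b) {0..}"
    using Gamma_integral_real[of b] assms by simp
  have tail: "((\<lambda>t. exp (- t)) has_integral exp (- x)) {x..}"
    using has_integral_exp_minus_to_infinity[of 1 x] by simp
  have "x powr (b - 1) * exp (- x) \<le> Gamma b"
  proof (rule has_integral_le)
    show "((\<lambda>t. if t \<in> {x..} then x powr (b - 1) * exp (- t) else 0)
            has_integral (x powr (b - 1) * exp (- x))) {0..}"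
      using has_integral_mult_right[OF tail, of "x powr (b - 1)"] assms
      by (subst has_integral_restrict) auto
    show "(if t \<in> {x..} then x powr (b - 1) * exp (- t) else 0) \<le> t powr (b - 1) / exp t"
      for t
      using assms by (auto simp: exp_minus divide_inverse intro!: mult_right_mono powr_mono2)
  qed (rule Gam)
  then show ?thesis by (simp add: exp_minus field_simps)
qed

text \<open>
  The Riemann--Liouville kernel: convolution with it is fractional integration of order \<open>b\<close>.
  It takes the value 0 at 0 for every \<open>b\<close>, including \<open>b = 1\<close>, because \<open>0 powr 0 = 0\<close>.
\<close>

definition power_kernel :: "real \<Rightarrow> real \<Rightarrow> real" where
  "power_kernel b t = t powr (b - 1) / Gamma b"

lemma power_kernel_nonneg: "0 < b \<Longrightarrow> 0 \<le> power_kernel b t"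
  using Gamma_real_pos[of b] by (simp add: power_kernel_def)

text \<open>
  The parameter \<open>\<sigma>\<close> comes from scaling, \<open>x = \<sigma> t\<close>. Choosing \<open>\<sigma> > 1\<close> makes the bound decay
  geometrically in the exponent \<open>b\<close>, without any asymptotics of the Gamma function.
\<close>

lemma power_kernel_le_exp:
  assumes "1 \<le> b" "0 < \<sigma>" "0 \<le> t"
  shows "power_kernel b t \<le> \<sigma> powr (1 - b) * exp (\<sigma> * t)"
proof -
  have "\<sigma> powr (b - 1) * t powr (b - 1) \<le> exp (\<sigma> * t) * Gamma b"
    using powr_le_exp_mult_Gamma[of b "\<sigma> * t"] assms by (simp add: powr_mult)
  moreover have "\<sigma> powr (1 - b) * \<sigma> powr (b - 1) = 1"
    using assms by (simp flip: powr_add)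
  ultimately have "t powr (b - 1) \<le> \<sigma> powr (1 - b) * exp (\<sigma> * t) * Gamma b"
    using mult_left_mono[of "\<sigma> powr (b - 1) * t powr (b - 1)" "exp (\<sigma> * t) * Gamma b" "\<sigma> powr (1 - b)"]
    by (simp add: mult.assoc[symmetric])
  moreover have "0 < Gamma b" using assms by (simp add: Gamma_real_pos)
  ultimately show ?thesis by (simp add: power_kernel_def divide_le_eq)
qed

text \<open>
  The beta integral, rescaled from \<open>[0, 1]\<close> to \<open>[0, t]\<close>.
\<close>

lemma power_kernel_convolution:
  assumes "0 < a" "0 < b" "0 < t"
  shows "((\<lambda>s. power_kernel a (t - s) * power_kernel b s) has_integral power_kernel (a + b) t) {0..t}"
proof -
  have Gam: "0 < Gamma a" "0 < Gamma b" "0 < Gamma (a + b)"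
    using assms by (simp_all add: Gamma_real_pos)
  have "((\<lambda>x. x powr (b - 1) * (1 - x) powr (a - 1)) has_integral Beta b a) {0..1}"
    using has_integral_Beta_real[of b a] assms by simp
  from has_integral_stretch_real[OF this, of "1 / t"]
  have "((\<lambda>s. (s / t) powr (b - 1) * (1 - s / t) powr (a - 1)) has_integral (t * Beta b a)) {0..t}"
    using assms by (simp add: image_mult_atLeastAtMost_if')
  from has_integral_mult_right[OF this, of "t powr (a + b - 2) / (Gamma a * Gamma b)"]
  have "((\<lambda>s. t powr (a + b - 2) / (Gamma a * Gamma b)
            * ((s / t) powr (b - 1) * (1 - s / t) powr (a - 1)))
         has_integral t powr (a + b - 2) / (Gamma a * Gamma b) * (t * Beta b a)) {0..t}" .
  also have "t powr (a + b - 2) / (Gamma a * Gamma b) * (t * Beta b a) = power_kernel (a + b) t"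
  proof -
    have "t powr (a + b - 2) * t = t powr (a + b - 1)"
      using assms powr_add[of t "a + b - 2" 1] by simp
    then show ?thesis using Gam by (simp add: power_kernel_def Beta_def add.commute field_simps)
  qed
  finally show ?thesis
  proof (rule has_integral_eq[rotated])
    fix s assume "s \<in> {0..t}"
    then have "1 - s / t = (t - s) / t" and "0 \<le> s" "0 \<le> t - s" using assms by (auto simp: field_simps)
    moreover have "t powr (a + b - 2) = t powr (a - 1) * t powr (b - 1)"
      by (simp flip: powr_add add: algebra_simps)
    ultimately show "t powr (a + b - 2) / (Gamma a * Gamma b)
        * ((s / t) powr (b - 1) * (1 - s / t) powr (a - 1)) = power_kernel a (t - s) * power_kernel b s"
      using assms by (simp add: power_kernel_def powr_divide)
  qed
qed

text \<open>
  The semigroup law with \<open>b = 1\<close>, where the second factor is constantly 1 except at the point 0.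
\<close>

lemma power_kernel_integrable:
  assumes "0 < a" "0 < t"
  shows "(\<lambda>s. power_kernel a (t - s)) integrable_on {0..t}"
proof (rule integrable_spike_finite[where S = "{0}"])
  show "(\<lambda>s. power_kernel a (t - s) * power_kernel 1 s) integrable_on {0..t}"
    by (rule has_integral_integrable[OF power_kernel_convolution]) (use assms in auto)
qed (auto simp: power_kernel_def)

lemma power_kernel_antimono:
  assumes "0 < a" "a \<le> 1" "0 < x" "x \<le> y"
  shows "power_kernel a y \<le> power_kernel a x"
  unfolding power_kernel_def using assms Gamma_real_pos[of a]
  by (intro divide_right_mono powr_mono2') auto

lemma power_kernel_mono:
  assumes "1 \<le> b" "0 < x" "x \<le> y"
  shows "power_kernel b x \<le> power_kernel b y"
  unfolding power_kernel_def using assms Gamma_real_pos[of b]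
  by (intro divide_right_mono powr_mono2) auto

lemma continuous_on_power_kernel: "continuous_on {0<..} (power_kernel b)"
  unfolding power_kernel_def divide_inverse by (intro continuous_intros) auto

section \<open>The Neumann series\<close>

text \<open>
  The parameters of a multinomial Mittag-Leffler function with arguments \<open>- c j * t powr a j\<close>. The
  function \<open>kernel\<close> is the Volterra kernel, \<open>iterate m\<close> the \<open>m\<close>-th term of the Neumann series for
  the right-hand side \<open>power_kernel b\<close>, and \<open>ratio \<sigma>\<close> is the integral of \<open>exp (- \<sigma> t) * kernel t\<close> over
  the half-line, which bounds the growth of the iterates per step in the norm weighted by
  \<open>exp (- \<sigma> t)\<close>.
\<close>

locale multiterm_fractional =
  fixes n :: nat and a c :: "nat \<Rightarrow> real" and b :: real
  assumes a_pos: "j < n \<Longrightarrow> 0 < a j" and a_le_1: "j < n \<Longrightarrow> a j \<le> 1"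
    and c_pos: "j < n \<Longrightarrow> 0 < c j" and b_ge_1: "1 \<le> b"
begin

definition kernel :: "real \<Rightarrow> real" where
  "kernel t = (\<Sum>j<n. c j * power_kernel (a j) t)"

definition ratio :: "real \<Rightarrow> real" where
  "ratio \<sigma> = (\<Sum>j<n. c j * \<sigma> powr (- a j))"

definition iterate :: "nat \<Rightarrow> real \<Rightarrow> real" where
  "iterate k t = multinomial_sum n k
     (\<lambda>ks. (\<Prod>j<n. (- c j) ^ (ks ! j)) * power_kernel (b + (\<Sum>j<n. a j * real (ks ! j))) t)"

definition solution :: "real \<Rightarrow> real" where
  "solution t = (\<Sum>k. iterate k t)"

lemma exponent_ge: "b \<le> b + (\<Sum>j<n. a j * real (ks ! j))"
proof -
  have "0 \<le> (\<Sum>j<n. a j * real (ks ! j))"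
    by (intro sum_nonneg mult_nonneg_nonneg) (use a_pos in \<open>auto simp: less_imp_le\<close>)
  then show ?thesis by simp
qed

lemma iterate_0: "iterate 0 t = power_kernel b t"
  by (simp add: iterate_def multinomial_sum_0)

lemma continuous_on_iterate: "continuous_on {0<..} (iterate k)"
  unfolding iterate_def multinomial_sum_def by (intro continuous_intros continuous_on_power_kernel)

text \<open>
  The exponent \<open>1 - b - (\<Sum>j. a j * ks ! j)\<close> of \<open>\<sigma>\<close> distributes over the product, so the
  multinomial theorem sums the estimates of the single terms exactly.
\<close>

lemma abs_iterate_le:
  assumes "0 < \<sigma>" "0 \<le> t"
  shows "\<bar>iterate k t\<bar> \<le> \<sigma> powr (1 - b) * exp (\<sigma> * t) * ratio \<sigma> ^ k"
proof -
  have "\<bar>iterate k t\<bar> \<le> multinomial_sum n k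
      (\<lambda>ks. \<sigma> powr (1 - b) * exp (\<sigma> * t) * (\<Prod>j<n. (c j * \<sigma> powr (- a j)) ^ (ks ! j)))"
    unfolding iterate_def
  proof (rule abs_multinomial_sum_le)
    fix ks :: "nat list"
    define e where "e = b + (\<Sum>j<n. a j * real (ks ! j))"
    have "1 \<le> e" using exponent_ge[of ks] b_ge_1 unfolding e_def by linarith
    have abs_prod: "\<bar>\<Prod>j<n. (- c j) ^ (ks ! j)\<bar> = (\<Prod>j<n. c j ^ (ks ! j))"
      unfolding abs_prod by (rule prod.cong) (use c_pos in \<open>auto simp: power_abs less_imp_le\<close>)
    have "\<sigma> powr (1 - e) = \<sigma> powr (1 - b) * (\<Prod>j<n. \<sigma> powr (- (a j * real (ks ! j))))"
      using assms by (simp add: e_def powr_sum[symmetric] powr_add[symmetric] sum_negf diff_diff_eq)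
    also have "(\<Prod>j<n. \<sigma> powr (- (a j * real (ks ! j)))) = (\<Prod>j<n. (\<sigma> powr (- a j)) ^ (ks ! j))"
      using assms by (simp add: powr_power mult.commute)
    finally have "\<sigma> powr (1 - e) = \<sigma> powr (1 - b) * (\<Prod>j<n. (\<sigma> powr (- a j)) ^ (ks ! j))" .
    then have rhs: "\<sigma> powr (1 - b) * exp (\<sigma> * t) * (\<Prod>j<n. (c j * \<sigma> powr (- a j)) ^ (ks ! j))
        = (\<Prod>j<n. c j ^ (ks ! j)) * (\<sigma> powr (1 - e) * exp (\<sigma> * t))"
      by (simp add: power_mult_distrib prod.distrib mult_ac)
    have "0 \<le> (\<Prod>j<n. c j ^ (ks ! j))"
      by (intro prod_nonneg) (use c_pos in \<open>auto simp: less_imp_le\<close>)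
    then have "(\<Prod>j<n. c j ^ (ks ! j)) * power_kernel e t
        \<le> (\<Prod>j<n. c j ^ (ks ! j)) * (\<sigma> powr (1 - e) * exp (\<sigma> * t))"
      by (intro mult_left_mono power_kernel_le_exp \<open>1 \<le> e\<close> assms)
    then show "\<bar>(\<Prod>j<n. (- c j) ^ (ks ! j)) * power_kernel (b + (\<Sum>j<n. a j * real (ks ! j))) t\<bar>
        \<le> \<sigma> powr (1 - b) * exp (\<sigma> * t) * (\<Prod>j<n. (c j * \<sigma> powr (- a j)) ^ (ks ! j))"
      using power_kernel_nonneg[of e t] \<open>1 \<le> e\<close> unfolding rhs abs_mult abs_prod e_def[symmetric] by simp
  qed
  then show ?thesis
    by (simp only: multinomial_sum_mult multinomial_theorem ratio_def)
qed

lemma ratio_tendsto_0: "(ratio \<longlongrightarrow> 0) at_top"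
proof -
  have "((\<lambda>\<sigma>. \<Sum>j<n. c j * \<sigma> powr (- a j)) \<longlongrightarrow> (\<Sum>j<n. c j * 0)) at_top"
    by (intro tendsto_intros tendsto_neg_powr filterlim_ident) (use a_pos in auto)
  then show ?thesis by (simp add: ratio_def[abs_def])
qed

lemma ratio_nonneg: "0 \<le> ratio \<sigma>"
  unfolding ratio_def by (intro sum_nonneg) (use c_pos in \<open>auto simp: less_imp_le\<close>)

lemma kernel_nonneg: "0 \<le> kernel x"
  unfolding kernel_def
  by (intro sum_nonneg mult_nonneg_nonneg power_kernel_nonneg) (use a_pos c_pos in \<open>auto simp: less_imp_le\<close>)

lemma kernel_antimono: "0 < x \<Longrightarrow> x \<le> y \<Longrightarrow> kernel y \<le> kernel x"
  unfolding kernel_def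
  by (intro sum_mono mult_left_mono power_kernel_antimono) (use a_pos a_le_1 c_pos in \<open>auto simp: less_imp_le\<close>)

lemma kernel_integrable: "0 < t \<Longrightarrow> (\<lambda>s. kernel (t - s)) integrable_on {0..t}"
  unfolding kernel_def
  by (intro integrable_sum integrable_on_mult_right power_kernel_integrable) (use a_pos in auto)

text \<open>
  Raising the entry \<open>j\<close> of \<open>ks\<close> multiplies the coefficient by \<open>- c j\<close> and convolves the power
  with \<open>power_kernel (a j)\<close>, so Pascal's recursion is the iteration step.
\<close>

lemma kernel_convolution_iterate:
  assumes "0 < t"
  shows "((\<lambda>s. kernel (t - s) * iterate k s) has_integral - iterate (Suc k) t) {0..t}"
proof -
  define p where "p = (\<lambda>ks. \<Prod>j<n. (- c j) ^ (ks ! j))"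
  define e where "e = (\<lambda>ks. b + (\<Sum>j<n. a j * real (ks ! j)))"
  have e_pos: "0 < e ks" for ks
    using exponent_ge[of ks] b_ge_1 unfolding e_def by linarith
  have "iterate (Suc k) t
      = (\<Sum>j<n. multinomial_sum n k (\<lambda>ks. - (c j * p ks * power_kernel (a j + e ks) t)))"
    unfolding iterate_def multinomial_sum_Suc
    by (intro sum.cong multinomial_sum_cong refl)
       (simp add: prod_power_list_update_Suc sum_list_update_Suc p_def e_def add_ac)
  also have "\<dots> = - (\<Sum>j<n. multinomial_sum n k (\<lambda>ks. c j * p ks * power_kernel (a j + e ks) t))"
    by (simp add: multinomial_sum_def sum_negf)
  finally have Suc_eq: "- iterate (Suc k) t
      = (\<Sum>j<n. multinomial_sum n k (\<lambda>ks. c j * p ks * power_kernel (a j + e ks) t))"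
    by simp
  have "((\<lambda>s. \<Sum>j<n. multinomial_sum n k (\<lambda>ks. c j * p ks * (power_kernel (a j) (t - s) * power_kernel (e ks) s)))
          has_integral - iterate (Suc k) t) {0..t}"
    unfolding Suc_eq
    by (intro has_integral_sum has_integral_multinomial_sum has_integral_mult_right
          power_kernel_convolution assms e_pos) (use a_pos in auto)
  moreover have "(\<Sum>j<n. multinomial_sum n k (\<lambda>ks. c j * p ks * (power_kernel (a j) (t - s) * power_kernel (e ks) s)))
      = kernel (t - s) * iterate k s" for s
  proof -
    have "multinomial_sum n k (\<lambda>ks. c j * p ks * (power_kernel (a j) (t - s) * power_kernel (e ks) s))
        = c j * power_kernel (a j) (t - s) * iterate k s" for j
      unfolding iterate_def multinomial_sum_mult[symmetric] p_def e_def by (simp add: mult_ac)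
    then show ?thesis by (simp add: kernel_def sum_distrib_right)
  qed
  ultimately show ?thesis by simp
qed

lemma ex_ratio_le_half: "\<exists>\<sigma>>0. ratio \<sigma> \<le> 1/2"
proof -
  have "eventually (\<lambda>\<sigma>. ratio \<sigma> < 1/2) at_top"
    by (rule order_tendstoD(2)[OF ratio_tendsto_0]) simp
  then obtain N where "\<And>\<sigma>. N \<le> \<sigma> \<Longrightarrow> ratio \<sigma> < 1/2"
    unfolding eventually_at_top_linorder by blast
  then show ?thesis by (intro exI[of _ "max 1 N"]) (auto intro: less_imp_le)
qed

lemma iterate_geometric_bound:
  obtains B where "\<And>k t. 0 \<le> t \<Longrightarrow> t \<le> T \<Longrightarrow> \<bar>iterate k t\<bar> \<le> B * (1/2) ^ k" "0 \<le> B"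
proof -
  obtain \<sigma> where \<sigma>: "0 < \<sigma>" "ratio \<sigma> \<le> 1/2" using ex_ratio_le_half by blast
  have "\<bar>iterate k t\<bar> \<le> \<sigma> powr (1 - b) * exp (\<sigma> * T) * (1/2) ^ k" if "0 \<le> t" "t \<le> T" for k t
    using \<sigma> that ratio_nonneg
    by (intro order.trans[OF abs_iterate_le[of \<sigma>]] mult_mono power_mono) auto
  then show thesis by (intro that) auto
qed

lemma iterate_summable: "0 \<le> t \<Longrightarrow> summable (\<lambda>k. iterate k t)"
proof -
  assume "0 \<le> t"
  obtain B where B: "\<And>k s. 0 \<le> s \<Longrightarrow> s \<le> t \<Longrightarrow> \<bar>iterate k s\<bar> \<le> B * (1/2) ^ k"
    using iterate_geometric_bound[of t] by blast
  show ?thesis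
    by (rule summable_comparison_test'[where N = 0 and g = "\<lambda>k. B * (1/2) ^ k"])
       (use B \<open>0 \<le> t\<close> in \<open>auto intro: summable_mult summable_geometric\<close>)
qed

lemma continuous_on_solution: "continuous_on {0<..} solution"
proof -
  have "continuous_on {0<..<T} solution" for T
  proof -
    obtain B where B: "\<And>k s. 0 \<le> s \<Longrightarrow> s \<le> T \<Longrightarrow> \<bar>iterate k s\<bar> \<le> B * (1/2) ^ k"
      using iterate_geometric_bound[of T] by blast
    have "uniform_limit {0<..<T} (\<lambda>N t. \<Sum>k<N. iterate k t) solution sequentially"
      unfolding solution_def[abs_def]
      by (rule Weierstrass_m_test[where M = "\<lambda>k. B * (1/2) ^ k"])
         (use B in \<open>auto intro: summable_mult summable_geometric\<close>)
    then show ?thesis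
      by (rule uniform_limit_theorem[rotated])
         (auto intro!: always_eventually continuous_intros
            intro: continuous_on_subset[OF continuous_on_iterate])
  qed
  then have "continuous_on (\<Union>T. {0<..<T}) solution"
    by (intro continuous_on_open_UN) auto
  moreover have "(\<Union>T. {0<..<T}) = {0::real<..}"
    using gt_ex by fastforce
  ultimately show ?thesis by simp
qed

text \<open>
  Summation of the iteration step. Sum and integral may be exchanged by dominated convergence, as
  the partial sums are bounded on \<open>[0, t]\<close> and the kernel is integrable.
\<close>

lemma solution_volterra:
  assumes "0 < t"
  shows "((\<lambda>s. kernel (t - s) * solution s) has_integral power_kernel b t - solution t) {0..t}"
proof -
  obtain B where B: "\<And>k s. 0 \<le> s \<Longrightarrow> s \<le> t \<Longrightarrow> \<bar>iterate k s\<bar> \<le> B * (1/2) ^ k" and "0 \<le> B"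
    using iterate_geometric_bound[of t] by blast
  define S where "S = (\<lambda>N s. \<Sum>k<N. iterate k s)"
  have S_int: "((\<lambda>s. kernel (t - s) * S N s) has_integral (\<Sum>k<N. - iterate (Suc k) t)) {0..t}" for N
    unfolding S_def sum_distrib_left
    by (intro has_integral_sum kernel_convolution_iterate assms) auto
  have S_le: "\<bar>S N s\<bar> \<le> B * 2" if "s \<in> {0..t}" for N s
  proof -
    have "\<bar>S N s\<bar> \<le> (\<Sum>k<N. B * (1/2) ^ k)"
      unfolding S_def using that by (intro order.trans[OF sum_abs] sum_mono B) auto
    also have "\<dots> \<le> (\<Sum>k. B * (1/2) ^ k)"
      using \<open>0 \<le> B\<close> by (intro sum_le_suminf summable_mult summable_geometric) auto
    also have "\<dots> = B * 2"
      by (subst suminf_mult) (auto simp: suminf_geometric summable_geometric)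
    finally show ?thesis .
  qed
  have S_lim: "(\<lambda>N. S N s) \<longlonglongrightarrow> solution s" if "s \<in> {0..t}" for s
    unfolding S_def solution_def using that by (intro summable_LIMSEQ iterate_summable) auto
  have h_int: "(\<lambda>s. kernel (t - s) * (B * 2)) integrable_on {0..t}"
    by (intro integrable_on_mult_left kernel_integrable assms)
  have S_dom: "norm (kernel (t - s) * S N s) \<le> kernel (t - s) * (B * 2)" if "s \<in> {0..t}" for N s
    using kernel_nonneg S_le[OF that] by (simp add: abs_mult mult_left_mono)
  note limit = dominated_convergence[where f = "\<lambda>N s. kernel (t - s) * S N s" and S = "{0..t}"
      and h = "\<lambda>s. kernel (t - s) * (B * 2)" and g = "\<lambda>s. kernel (t - s) * solution s",
      OF has_integral_integrable[OF S_int] h_int S_dom tendsto_mult[OF tendsto_const S_lim]]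
  have "(\<lambda>k. - iterate (Suc k) t) sums (power_kernel b t - solution t)"
    using sums_minus[OF sums_Suc_iff[THEN iffD2, of "\<lambda>k. iterate k t" "solution t - power_kernel b t"]]
      summable_sums[OF iterate_summable, of t] assms
    by (simp add: iterate_0 solution_def)
  then have "integral {0..t} (\<lambda>s. kernel (t - s) * solution s) = power_kernel b t - solution t"
    using LIMSEQ_unique limit(2) by (simp add: integral_unique[OF S_int] sums_def)
  then show ?thesis using limit(1) by (simp add: has_integral_iff)
qed

text \<open>
  With \<open>\<sigma> = 1 / t\<close> the bound on the \<open>k\<close>-th iterate becomes \<open>exp 1 * t powr (b - 1) * r ^ k\<close>, where
  \<open>r = ratio (1 / t)\<close> tends to 0 with \<open>t\<close>. Hence the tail of the series is of smaller order than the
  leading term \<open>t powr (b - 1) / Gamma b\<close>.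
\<close>

lemma solution_pos_near_0: "\<exists>d>0. \<forall>t. 0 < t \<longrightarrow> t < d \<longrightarrow> 0 < solution t"
proof -
  have Gam: "0 < Gamma b" using b_ge_1 by (simp add: Gamma_real_pos)
  \<comment> \<open>The tail is at most \<open>2 * exp 1 * r * t powr (b - 1)\<close> for \<open>r < 1/2\<close>; the factor 4 makes it
      at most half of the leading term.\<close>
  define \<epsilon> where "\<epsilon> = min (1/2) (1 / (4 * exp 1 * Gamma b))"
  have "0 < \<epsilon>" using Gam by (simp add: \<epsilon>_def)
  then have "eventually (\<lambda>\<sigma>. ratio \<sigma> < \<epsilon>) at_top"
    by (rule order_tendstoD(2)[OF ratio_tendsto_0])
  then obtain N where N: "\<And>\<sigma>. N \<le> \<sigma> \<Longrightarrow> ratio \<sigma> < \<epsilon>"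
    unfolding eventually_at_top_linorder by blast
  have "0 < solution t" if "0 < t" "t < 1 / max 1 N" for t
  proof -
    define r where "r = ratio (1 / t)"
    have "max 1 N < 1 / t"
      using that less_imp_inverse_less[of t "1 / max 1 N"] by (simp add: inverse_eq_divide)
    then have "r < \<epsilon>" unfolding r_def by (intro N) auto
    then have r: "0 \<le> r" "r < 1/2" "r < 1 / (4 * exp 1 * Gamma b)"
      by (auto simp: r_def \<epsilon>_def ratio_nonneg)
    define A where "A = t powr (b - 1) * exp 1"
    have "0 < A" using that by (simp add: A_def)
    have A: "\<bar>iterate k t\<bar> \<le> A * r ^ k" for k
    proof -
      have "(1 / t) powr (1 - b) = t powr (b - 1)"
        using that powr_minus_divide[of t "1 - b"] by (simp add: powr_divide)
      then show ?thesis using abs_iterate_le[of "1 / t" t k] that by (simp add: A_def r_def)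
    qed
    have sums_r: "(\<lambda>k. A * r ^ Suc k) sums (A * r * (1 / (1 - r)))"
      using sums_mult[OF geometric_sums[of r], of "A * r"] r by (simp add: mult_ac)
    have "solution t = power_kernel b t + (\<Sum>k. iterate (Suc k) t)"
      using suminf_split_head[OF iterate_summable[of t]] that by (simp add: solution_def iterate_0)
    moreover have "\<bar>\<Sum>k. iterate (Suc k) t\<bar> \<le> A * r * (1 / (1 - r))"
    proof -
      have "norm (\<Sum>k. iterate (Suc k) t) \<le> (\<Sum>k. A * r ^ Suc k)"
        by (rule norm_suminf_le) (use A[of "Suc _"] sums_r in \<open>auto dest: sums_summable\<close>)
      then show ?thesis using sums_unique[OF sums_r] by simp
    qed
    moreover have "A * r * (1 / (1 - r)) \<le> A * r * 2"
      using r \<open>0 < A\<close> by (intro mult_left_mono) (auto simp: field_simps)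
    moreover have "A * r * 2 < power_kernel b t"
    proof -
      have "A * r * 2 \<le> A * (1 / (4 * exp 1 * Gamma b)) * 2"
        using r \<open>0 < A\<close> by (intro mult_right_mono mult_left_mono) auto
      also have "\<dots> = power_kernel b t / 2" by (simp add: A_def power_kernel_def)
      also have "\<dots> < power_kernel b t" using that Gam by (simp add: power_kernel_def divide_strict_left_mono)
      finally show ?thesis .
    qed
    ultimately show ?thesis by linarith
  qed
  moreover have "0 < 1 / max 1 N" by simp
  ultimately show ?thesis by blast
qed

lemma solution_pos:
  assumes "0 < t"
  shows "0 < solution t"
proof -
  obtain d where "0 < d" "\<And>t. 0 < t \<Longrightarrow> t < d \<Longrightarrow> 0 < solution t"
    using solution_pos_near_0 by blast
  then show ?thesis
    using volterra_solution_pos[of kernel "power_kernel b" solution d t] kernel_nonneg kernel_antimono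
      kernel_integrable power_kernel_mono[OF b_ge_1] continuous_on_solution solution_volterra assms
    by blast
qed

end

section \<open>Positivity of the multinomial Mittag-Leffler function\<close>

text \<open>
  Here the powers of \<open>t\<close> in the arguments are collected, so that \<open>t powr (b - 1)\<close> times the
  Mittag-Leffler series becomes termwise the Neumann series.
\<close>

theorem multinomial_ML_pos:
  fixes as cs ss :: "real list" and b t :: real
  assumes "\<And>j. j < length as \<Longrightarrow> 0 < as ! j \<and> as ! j \<le> 1"
    and "\<And>j. j < length as \<Longrightarrow> 0 < cs ! j"
    and ss: "\<And>j. j < length as \<Longrightarrow> ss ! j = - (cs ! j) * t powr (as ! j)"
    and "1 \<le> b" and "0 < t"
  shows "0 < multinomial_ML as b ss"
proof -
  interpret multiterm_fractional "length as" "\<lambda>j. as ! j" "\<lambda>j. cs ! j" b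
    using assms by unfold_locales auto
  let ?n = "length as"
  have "iterate k t = t powr (b - 1) * (\<Sum>ks | length ks = ?n \<and> sum_list ks = k.
        fact k / (\<Prod>j<?n. fact (ks ! j))
        * ((\<Prod>j<?n. (ss ! j) ^ (ks ! j)) / Gamma (b + (\<Sum>j<?n. as ! j * real (ks ! j)))))"
    (is "_ = _ * ?term k") for k
  proof -
    have "(\<Prod>j<?n. (- (cs ! j)) ^ (ks ! j)) * power_kernel (b + (\<Sum>j<?n. as ! j * real (ks ! j))) t
      = t powr (b - 1) * ((\<Prod>j<?n. (ss ! j) ^ (ks ! j)) / Gamma (b + (\<Sum>j<?n. as ! j * real (ks ! j))))"
      for ks :: "nat list"
    proof -
      have "(\<Prod>j<?n. (ss ! j) ^ (ks ! j))
          = (\<Prod>j<?n. (- (cs ! j)) ^ (ks ! j)) * (\<Prod>j<?n. (t powr (as ! j)) ^ (ks ! j))"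
        unfolding prod.distrib[symmetric] power_mult_distrib[symmetric]
        by (rule prod.cong) (simp_all add: ss)
      also have "(\<Prod>j<?n. (t powr (as ! j)) ^ (ks ! j)) = t powr (\<Sum>j<?n. as ! j * real (ks ! j))"
        using \<open>0 < t\<close> by (simp add: powr_power powr_sum mult.commute)
      finally show ?thesis
        using powr_add[of t "b - 1" "\<Sum>j<?n. as ! j * real (ks ! j)"]
        by (simp add: power_kernel_def algebra_simps)
    qed
    then show ?thesis
      unfolding iterate_def multinomial_sum_mult[symmetric] weak_compositions_def[symmetric]
      by (simp add: multinomial_sum_def sum_distrib_left mult_ac)
  qed
  then have "(\<lambda>k. iterate k t) = (\<lambda>k. t powr (b - 1) * ?term k)" by auto
  moreover from this have "summable ?term"
    using iterate_summable[of t] \<open>0 < t\<close> by (simp add: summable_cmult_iff)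
  ultimately have "solution t = t powr (b - 1) * multinomial_ML as b ss"
    unfolding solution_def multinomial_ML_def by (simp add: suminf_mult)
  then show ?thesis using solution_pos[OF \<open>0 < t\<close>] \<open>0 < t\<close> by (simp add: zero_less_mult_iff)
qed

theorem lemmaA2:
  fixes l :: nat and \<alpha> q :: "nat \<Rightarrow> real" and \<beta> lam :: real
  assumes "l \<ge> 1"
    and "0 < \<alpha> l"
    and "\<And>i j. 1 \<le> i \<Longrightarrow> i < j \<Longrightarrow> j \<le> l \<Longrightarrow> \<alpha> j < \<alpha> i"
    and "\<alpha> 1 \<le> 1"
    and "\<And>j. 2 \<le> j \<Longrightarrow> j \<le> l \<Longrightarrow> 0 < q j"
    and "1 < \<beta>" and "\<beta> < 1 + \<alpha> 1"
    and "0 < lam"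
  shows "\<forall>t>0. multinomial_ML
            (\<alpha> 1 # map (\<lambda>j. \<alpha> 1 - \<alpha> j) (rev [2..<Suc l]))
            \<beta>
            (- lam * t powr \<alpha> 1 # map (\<lambda>j. - q j * t powr (\<alpha> 1 - \<alpha> j)) (rev [2..<Suc l])) > 0"
proof (intro allI impI)
  fix t :: real assume "0 < t"
  let ?r = "rev [2..<Suc l]"
  have r: "2 \<le> ?r ! i" "?r ! i \<le> l" if "i < length ?r" for i
    using nth_mem[OF that] by (auto simp del: upt_Suc)
  \<comment> \<open>The \<open>\<alpha> j\<close> decrease, so all of them are at least \<open>\<alpha> l\<close>; hence each \<open>\<alpha> 1 - \<alpha> j\<close> is less than 1.\<close>
  have \<alpha>_pos: "0 < \<alpha> j" if "1 \<le> j" "j \<le> l" for j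
    using assms(2) assms(3)[of j l] that by (cases "j = l") auto
  show "0 < multinomial_ML (\<alpha> 1 # map (\<lambda>j. \<alpha> 1 - \<alpha> j) ?r) \<beta>
      (- lam * t powr \<alpha> 1 # map (\<lambda>j. - q j * t powr (\<alpha> 1 - \<alpha> j)) ?r)"
  proof (rule multinomial_ML_pos[where cs = "lam # map q ?r"])
    fix i assume i: "i < length (\<alpha> 1 # map (\<lambda>j. \<alpha> 1 - \<alpha> j) ?r)"
    show "0 < (\<alpha> 1 # map (\<lambda>j. \<alpha> 1 - \<alpha> j) ?r) ! i \<and> (\<alpha> 1 # map (\<lambda>j. \<alpha> 1 - \<alpha> j) ?r) ! i \<le> 1"
    proof (cases i)
      case 0
      then show ?thesis using \<alpha>_pos[of 1] assms(1,4) by simp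
    next
      case (Suc m)
      then have m: "m < length ?r" using i by (simp del: upt_Suc)
      then show ?thesis
        using Suc r[OF m] assms(3)[of 1 "?r ! m"] \<alpha>_pos[of "?r ! m"] assms(4)
        by (simp del: upt_Suc)
    qed
    show "0 < (lam # map q ?r) ! i"
    proof (cases i)
      case 0
      then show ?thesis using assms by simp
    next
      case (Suc m)
      then have m: "m < length ?r" using i by (simp del: upt_Suc)
      then show ?thesis using Suc r[OF m] assms(5)[of "?r ! m"] by (simp del: upt_Suc)
    qed
    show "(- lam * t powr \<alpha> 1 # map (\<lambda>j. - q j * t powr (\<alpha> 1 - \<alpha> j)) ?r) ! i
        = - ((lam # map q ?r) ! i) * t powr ((\<alpha> 1 # map (\<lambda>j. \<alpha> 1 - \<alpha> j) ?r) ! i)"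
      using i by (cases i) (simp_all del: upt_Suc)
  qed (use assms \<open>0 < t\<close> in auto)
qed

end
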